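(* For any real $\xi\ge0$, there exists a point $x_0\in[0,1)$ such that $\gamma(x_0)=\xi$.
   Context: For irrational $x\in[0,1)$ with continued fraction expansion $x=[a_1(x),a_2(x),\dots]=\cfrac1{a_1(x)+\cfrac1{a_2(x)+\ddots}}$ (the $a_n(x)$ being positive integers), the Khintchine exponent is $\gamma(x)=\lim_{n\to\infty}\frac1n\sum_{j=1}^n\log a_j(x)$ when the limit exists. *)

theory Defs
  imports "HOL-Analysis.Analysis"
begin

text \<open>The finite continued fraction with partial quotients
  \<open>a k, a (k + 1), \<dots>, a (k + n - 1)\<close>.\<close>

fun cf_finite :: "(nat \<Rightarrow> nat) \<Rightarrow> nat \<Rightarrow> nat \<Rightarrow> real" where
  "cf_finite a k 0 = 0"
| "cf_finite a k (Suc n) = 1 / (real (a k) + cf_finite a (Suc k) n)"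

text \<open>\<open>x = [a 1, a 2, \<dots>]\<close>; the value \<open>a 0\<close> is irrelevant.\<close>

definition is_cf_expansion :: "(nat \<Rightarrow> nat) \<Rightarrow> real \<Rightarrow> bool" where
  "is_cf_expansion a x \<longleftrightarrow>
     (\<forall>n\<ge>1. a n \<ge> 1) \<and> (\<lambda>n. cf_finite a 1 n) \<longlonglongrightarrow> x"

text \<open>The partial quotient \<open>a\<^sub>n(x)\<close>, for irrational \<open>x \<in> [0,1)\<close> and \<open>n \<ge> 1\<close>;
  by \<open>cf_digit_eq\<close> below it does not depend on the choice of the expansion.\<close>

definition cf_digit :: "real \<Rightarrow> nat \<Rightarrow> nat" where
  "cf_digit x n = (THE k. \<exists>a. is_cf_expansion a x \<and> a n = k)"

text \<open>\<open>\<gamma>(x)\<close> exists and equals \<open>\<xi>\<close>. For \<open>n = 0\<close> the mean is \<open>0\<close> by the convention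
  \<open>1 / 0 = 0\<close>, which does not affect the limit.\<close>

definition has_khintchine_exponent :: "real \<Rightarrow> real \<Rightarrow> bool" where
  "has_khintchine_exponent x \<xi> \<longleftrightarrow>
     (\<lambda>n. 1 / real n * (\<Sum>j=1..n. ln (real (cf_digit x j)))) \<longlonglongrightarrow> \<xi>"

lemma cf_finite_bounds:
  assumes "\<forall>n\<ge>k. a n \<ge> 1"
  shows "0 \<le> cf_finite a k n \<and> cf_finite a k n \<le> 1"
  using assms
proof (induction n arbitrary: k)
  case (Suc n)
  have "0 \<le> cf_finite a (Suc k) n" using Suc by auto
  moreover have "real (a k) \<ge> 1" using Suc.prems by simp
  ultimately show ?case by (simp add: divide_le_eq_1)
qed simp

lemma cf_tail_step:
  assumes a: "\<forall>n\<ge>k. a n \<ge> 1" and lim: "(\<lambda>n. cf_finite a k n) \<longlonglongrightarrow> x"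
  shows "x > 0" "(\<lambda>n. cf_finite a (Suc k) n) \<longlonglongrightarrow> 1 / x - real (a k)"
    "0 \<le> 1 / x - real (a k)" 
proof -
  have a': "\<forall>n\<ge>Suc k. a n \<ge> 1" using a by simp
  note b = cf_finite_bounds[OF a']
  have ak: "real (a k) \<ge> 1" using a by simp
  have lim': "(\<lambda>n. cf_finite a k (Suc n)) \<longlonglongrightarrow> x"
    using lim by (rule LIMSEQ_Suc)
  have "1 / (real (a k) + 1) \<le> cf_finite a k (Suc n)" for n
    using b[of n] ak by (simp add: frac_le)
  hence "1 / (real (a k) + 1) \<le> x"
    by (intro LIMSEQ_le_const[OF lim']) auto
  moreover have "1 / (real (a k) + 1) > 0" by simp
  ultimately show x: "x > 0" by linarith
  have "(\<lambda>n. 1 / cf_finite a k (Suc n) - real (a k)) \<longlonglongrightarrow> 1 / x - real (a k)"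
    using x by (intro tendsto_intros lim') auto
  thus l: "(\<lambda>n. cf_finite a (Suc k) n) \<longlonglongrightarrow> 1 / x - real (a k)" by simp
  show "0 \<le> 1 / x - real (a k)"
    using b by (intro LIMSEQ_le_const[OF l]) auto
qed

lemma cf_tail_floor:
  assumes a: "\<forall>n\<ge>k. a n \<ge> 1" and lim: "(\<lambda>n. cf_finite a k n) \<longlonglongrightarrow> x"
  shows "int (a k) = \<lfloor>1 / x\<rfloor>"
proof -
  define y where "y = 1 / x - real (a k)"
  have a': "\<forall>n\<ge>Suc k. a n \<ge> 1" and a'': "\<forall>n\<ge>Suc (Suc k). a n \<ge> 1" using a by auto
  have ly: "(\<lambda>n. cf_finite a (Suc k) n) \<longlonglongrightarrow> y"
    unfolding y_def by (rule cf_tail_step(2)[OF a lim])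
  note s = cf_tail_step[OF a' ly]
  have "1 / y - real (a (Suc k)) > 0"
    by (rule cf_tail_step(1)[OF a'' s(2)])
  moreover have "real (a (Suc k)) \<ge> 1" using a by simp
  ultimately have "1 / y > 1" by linarith
  hence "y < 1" using s(1) by (simp add: field_simps)
  thus ?thesis using s(1) unfolding y_def by linarith
qed

lemma cf_tail_unique:
  assumes "\<forall>n\<ge>k. a n \<ge> 1" "(\<lambda>n. cf_finite a k n) \<longlonglongrightarrow> x"
    and "\<forall>n\<ge>k. b n \<ge> 1" "(\<lambda>n. cf_finite b k n) \<longlonglongrightarrow> x"
  shows "a (k + n) = b (k + n)"
  using assms
proof (induction n arbitrary: k x)
  case 0
  have "int (a k) = int (b k)"
    using cf_tail_floor[OF "0.prems"(1,2)] cf_tail_floor[OF "0.prems"(3,4)] by simp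
  thus ?case by simp
next
  case (Suc n)
  have "int (a k) = int (b k)"
    using cf_tail_floor[OF Suc.prems(1,2)] cf_tail_floor[OF Suc.prems(3,4)] by simp
  hence e: "a k = b k" by simp
  have "a (Suc k + n) = b (Suc k + n)"
  proof (rule Suc.IH)
    show "(\<lambda>n. cf_finite a (Suc k) n) \<longlonglongrightarrow> 1 / x - real (a k)"
      by (rule cf_tail_step(2)[OF Suc.prems(1,2)])
    show "(\<lambda>n. cf_finite b (Suc k) n) \<longlonglongrightarrow> 1 / x - real (a k)"
      unfolding e by (rule cf_tail_step(2)[OF Suc.prems(3,4)])
  qed (use Suc.prems in auto)
  thus ?case by simp
qed

lemma cf_digit_eq:
  assumes "is_cf_expansion a x" "n \<ge> 1"
  shows "cf_digit x n = a n"
  unfolding cf_digit_def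
proof (rule the_equality)
  show "\<exists>b. is_cf_expansion b x \<and> b n = a n" using assms by blast
next
  fix k assume "\<exists>b. is_cf_expansion b x \<and> b n = k"
  then obtain b where b: "is_cf_expansion b x" "b n = k" by blast
  have "b (1 + (n - 1)) = a (1 + (n - 1))"
    using assms b unfolding is_cf_expansion_def by (intro cf_tail_unique) auto
  thus "k = a n" using b assms(2) by simp
qed

end

theory Submission imports Defs begin

text \<open>Prescribe the partial quotients instead of the point: with \<open>\<theta> = \<xi> / ln 2\<close> let
  \<open>a n = 2 ^ (\<lfloor>n \<theta>\<rfloor> - \<lfloor>(n - 1) \<theta>\<rfloor>)\<close>, so that the sum of the logarithms telescopes to
  \<open>\<lfloor>n \<theta>\<rfloor> ln 2\<close>. Every sequence of positive integers is the expansion of some point,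
  because two steps of the continued fraction contract distances by \<open>1/4\<close>, and that point is
  irrational, because the tails of an expansion of \<open>p / q\<close> are positive fractions with strictly
  decreasing denominators.\<close>

text \<open>The difference equals \<open>s - t\<close> over a product of two factors, each at least
  2, whence 1/4. Two steps are taken at once because one step is no uniform contraction:
  \<open>1 / (b + s)\<close> has slope -1 in \<open>s\<close> at \<open>b = 1\<close>,
  \<open>s = 0\<close>.\<close>

lemma cf_two_step_contraction:
  fixes b c s t :: real
  assumes "b \<ge> 1" "c \<ge> 1" "s \<ge> 0" "t \<ge> 0"
  shows "\<bar>1 / (b + 1 / (c + s)) - 1 / (b + 1 / (c + t))\<bar> \<le> \<bar>s - t\<bar> / 4"
proof -
  have p: "b * (c + s) \<ge> 1" "b * (c + t) \<ge> 1"
    using assms mult_mono[of 1 b 1 "c + s"] mult_mono[of 1 b 1 "c + t"] by auto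
  have e: "1 / (b + 1 / (c + u)) = (c + u) / (b * (c + u) + 1)" if "u \<ge> 0" for u
    using that assms(2) by (simp add: field_simps)
  have "1 / (b + 1 / (c + s)) - 1 / (b + 1 / (c + t))
      = (s - t) / ((b * (c + s) + 1) * (b * (c + t) + 1))"
    unfolding e[OF assms(3)] e[OF assms(4)]
    using p by (subst diff_frac_eq) (simp_all add: algebra_simps)
  moreover have "\<bar>s - t\<bar> / ((b * (c + s) + 1) * (b * (c + t) + 1)) \<le> \<bar>s - t\<bar> / 4"
    using p mult_mono[of 2 "b * (c + s) + 1" 2 "b * (c + t) + 1"]
    by (intro divide_left_mono) auto
  ultimately show ?thesis using p by (simp add: abs_mult)
qed

text \<open>Both fractions share their first \<open>2 * j\<close> quotients. Each induction step
  strips two of them, and the remainders lie in [0,1].\<close>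

lemma cf_finite_diff_le:
  assumes "\<forall>n\<ge>k. a n \<ge> 1"
  shows "\<bar>cf_finite a k (2 * j + m) - cf_finite a k (2 * j + n)\<bar> \<le> (1 / 4) ^ j"
  using assms
proof (induction j arbitrary: k)
  case 0
  then show ?case
    using cf_finite_bounds[OF 0, of m] cf_finite_bounds[OF 0, of n] by (simp add: abs_le_iff)
next
  case (Suc j)
  have a: "\<forall>n\<ge>Suc (Suc k). a n \<ge> 1" using Suc.prems by simp
  have "\<bar>cf_finite a k (2 * Suc j + m) - cf_finite a k (2 * Suc j + n)\<bar>
      \<le> \<bar>cf_finite a (Suc (Suc k)) (2 * j + m) - cf_finite a (Suc (Suc k)) (2 * j + n)\<bar> / 4"
    using cf_two_step_contraction[of "a k" "a (Suc k)"] cf_finite_bounds[OF a] Suc.prems by simp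
  also have "\<dots> \<le> (1 / 4) ^ Suc j" using Suc.IH[OF a] by simp
  finally show ?case .
qed

lemma cf_finite_convergent:
  assumes "\<forall>n\<ge>k. a n \<ge> 1"
  shows "convergent (cf_finite a k)"
proof (rule Cauchy_convergent, rule metric_CauchyI)
  fix e :: real assume "e > 0"
  then obtain j where j: "(1 / 4) ^ j < e"
    using real_arch_pow_inv[of e "1 / 4"] by auto
  have "dist (cf_finite a k m) (cf_finite a k n) < e" if "m \<ge> 2 * j" "n \<ge> 2 * j" for m n
    using cf_finite_diff_le[OF assms, of j "m - 2 * j" "n - 2 * j"] j that
    by (simp add: dist_real_def)
  thus "\<exists>M. \<forall>m\<ge>M. \<forall>n\<ge>M. dist (cf_finite a k m) (cf_finite a k n) < e" by blast
qed

text \<open>Strictness comes from the tail: \<open>1 / x - a k\<close> is itself the limit of an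
  expansion, hence positive, so \<open>1 / x > a k\<close>, which is at least 1.\<close>

lemma cf_limit_less_1:
  assumes a: "\<forall>n\<ge>k. a n \<ge> 1" and lim: "cf_finite a k \<longlonglongrightarrow> x"
  shows "x < 1"
proof -
  have a': "\<forall>n\<ge>Suc k. a n \<ge> 1" using a by simp
  have "1 / x - real (a k) > 0"
    using cf_tail_step(1)[OF a' cf_tail_step(2)[OF a lim]] .
  moreover have "real (a k) \<ge> 1" using a by simp
  ultimately have "1 / x > 1" by linarith
  thus ?thesis using cf_tail_step(1)[OF a lim] by (simp add: field_simps)
qed

lemma cf_limit_not_fraction:
  fixes q :: nat and p :: int
  assumes "\<forall>n\<ge>k. a n \<ge> 1" "cf_finite a k \<longlonglongrightarrow> x" "q > 0"
  shows "x \<noteq> of_int p / real q"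
  using assms
proof (induction q arbitrary: p k x rule: less_induct)
  case (less q)
  show ?case
  proof
    assume x: "x = of_int p / real q"
    have "x > 0" using cf_tail_step(1)[OF less.prems(1,2)] .
    hence p: "p > 0" using x less.prems(3) by (simp add: zero_less_divide_iff)
    have "x < 1" using cf_limit_less_1[OF less.prems(1,2)] .
    hence pq: "nat p < q" using x less.prems(3) p by (simp add: divide_less_eq)
    \<comment> \<open>If \<open>x = p / q\<close>, the tail is the fraction on the right; its
      denominator \<open>p\<close> is smaller than \<open>q\<close>, so the induction hypothesis
      excludes it.\<close>
    have "1 / x - real (a k) \<noteq> of_int (int q - int (a k) * p) / real (nat p)"
      using less.prems p pq
      by (intro less.IH[where k = "Suc k"] cf_tail_step(2)) auto
    thus False using p less.prems(3) by (simp add: x field_simps)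
  qed
qed

lemma cf_expansion_exists:
  assumes a: "\<forall>n\<ge>1. a n \<ge> 1"
  shows "\<exists>x\<in>{0..<1} - \<rat>. is_cf_expansion a x"
proof -
  obtain x where x: "cf_finite a 1 \<longlonglongrightarrow> x"
    using cf_finite_convergent[OF a] by (auto simp: convergent_def)
  have "x \<notin> \<rat>"
  proof
    assume "x \<in> \<rat>"
    then obtain p q :: int where q: "q > 0" "x = of_int p / of_int q"
      by (elim Rats_cases') auto
    thus False using cf_limit_not_fraction[OF a x, of "nat q" p] by simp
  qed
  thus ?thesis
    using cf_tail_step(1)[OF a x] cf_limit_less_1[OF a x] a x
    by (intro bexI[of _ x]) (auto simp: is_cf_expansion_def)
qed

lemma tendsto_floor_mult_div:
  fixes \<theta> :: real
  shows "(\<lambda>n. of_int \<lfloor>real n * \<theta>\<rfloor> / real n) \<longlonglongrightarrow> \<theta>"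
proof (rule tendsto_sandwich)
  show "(\<lambda>n. \<theta> - 1 / real n) \<longlonglongrightarrow> \<theta>"
    using tendsto_diff[OF tendsto_const lim_1_over_n, of \<theta>] by simp
  \<comment> \<open>The bound is only eventual: at \<open>n = 0\<close> both divisions give 0, and
    it fails for positive \<theta>.\<close>
  show "\<forall>\<^sub>F n in sequentially. \<theta> - 1 / real n \<le> of_int \<lfloor>real n * \<theta>\<rfloor> / real n"
    using eventually_gt_at_top[of 0]
  proof eventually_elim
    case (elim n)
    have "real n * \<theta> - 1 \<le> of_int \<lfloor>real n * \<theta>\<rfloor>" by linarith
    hence "(real n * \<theta> - 1) / real n \<le> of_int \<lfloor>real n * \<theta>\<rfloor> / real n"
      by (rule divide_right_mono) simp
    thus ?case using elim by (simp add: diff_divide_distrib)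
  qed
  show "\<forall>\<^sub>F n in sequentially. of_int \<lfloor>real n * \<theta>\<rfloor> / real n \<le> \<theta>"
    using eventually_gt_at_top[of 0]
  proof eventually_elim
    case (elim n)
    have "of_int \<lfloor>real n * \<theta>\<rfloor> \<le> real n * \<theta>" by linarith
    thus ?case using elim by (simp add: field_simps)
  qed
qed simp

theorem proposition2p9:
  fixes \<xi> :: real
  assumes "\<xi> \<ge> 0"
  shows "\<exists>x0\<in>{0..<1} - \<rat>. has_khintchine_exponent x0 \<xi>"
proof -
  define \<theta> where "\<theta> = \<xi> / ln 2"
  define f where "f n = nat \<lfloor>real n * \<theta>\<rfloor>" for n
  define a :: "nat \<Rightarrow> nat" where "a n = 2 ^ (f n - f (n - 1))" for n
  have \<theta>: "\<theta> \<ge> 0" using assms by (simp add: \<theta>_def)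
  \<comment> \<open>Monotonicity makes the truncated subtraction in the exponent of \<open>a\<close>
    a true difference, so the sum telescopes.\<close>
  have mono: "f n \<le> f (Suc n)" for n
    unfolding f_def using \<theta> by (intro nat_mono floor_mono mult_right_mono) auto
  have sum: "(\<Sum>j=1..n. ln (real (a j))) = real (f n) * ln 2" for n
  proof (induction n)
    case 0
    show ?case by (simp add: f_def)
  next
    case (Suc n)
    have "ln (real (a (Suc n))) = (real (f (Suc n)) - real (f n)) * ln 2"
      using mono[of n] by (simp add: a_def ln_realpow of_nat_diff)
    thus ?case using Suc by (simp add: algebra_simps)
  qed
  obtain x where x: "x \<in> {0..<1} - \<rat>" "is_cf_expansion a x"
    using cf_expansion_exists[of a] by (auto simp: a_def)
  have "(\<Sum>j=1..n. ln (real (cf_digit x j))) = (\<Sum>j=1..n. ln (real (a j)))" for n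
    using cf_digit_eq[OF x(2)] by (intro sum.cong) auto
  hence "1 / real n * (\<Sum>j=1..n. ln (real (cf_digit x j)))
      = of_int \<lfloor>real n * \<theta>\<rfloor> / real n * ln 2" for n
    \<comment> \<open>Since \<theta> is nonnegative, \<open>nat\<close> in \<open>f\<close> loses
      nothing; at \<open>n = 0\<close> both sides are 0.\<close>
    using \<theta> by (simp only: sum) (simp add: f_def)
  moreover have "(\<lambda>n. of_int \<lfloor>real n * \<theta>\<rfloor> / real n * ln 2) \<longlonglongrightarrow> \<theta> * ln 2"
    by (intro tendsto_mult_right tendsto_floor_mult_div)
  ultimately have "has_khintchine_exponent x \<xi>"
    unfolding has_khintchine_exponent_def by (simp only: \<theta>_def) simp
  thus ?thesis using x(1) by blast
qed

end
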